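(* Assume $\Phi$ satisfies the Null Space Property of order $K$ with constant $\gamma$ such that $0<\gamma<1-\frac{2}{K+2}$. Suppose that $k<K-\frac{2\gamma}{1-\gamma}$ and $0<\rho<1$ are such that $$\mu:=\frac{\gamma(1+\gamma)}{1-\rho}\left(1+\frac{1}{K+1-k}\right)<1 .$$ Assume that $\mathcal{F}(y)$ contains a $k$-sparse vector $x^*$ and let $T=\operatorname{supp}(x^* )$. Let $(x^n)$ be the sequence produced by the IRLS algorithm described in the context and put $E_n:=\|x^n-x^*\|_{\ell_1}$. Let $n_0$ be such that $$E_{n_0}\le R^*:=\rho\,\min_{i\in T}|x^*_i| .$$ Then for all $n\ge n_0$ we have $$E_{n+1}\le\mu\,E_n .$$ Consequently $x^n$ converges to $x^*$ exponentially.
   Context: Setting: $m<N$ are positive integers, $\Phi$ is a real $m\times N$ matrix of full rank $m$, $y\in\mathbb{R}^m$, $\mathcal{N}:=\ker\Phi\subset\mathbb{R}^N$, $\mathcal{F}(y):=\{z\in\mathbb{R}^N:\Phi z=y\}$. $K$ is a fixed positive integer; $k$ denotes a nonnegative integer; $n_0\ge1$. A vector is $k$-sparse if it has at most $k$ nonzero coordinates. For $z\in\mathbb{R}^N$, $r(z)_i$ is the $i$-th largest of the numbers $|z_1|,\dots,|z_N|$ (counted with multiplicity). Null Space Property (NSP): $\Phi$ has the NSP of order $L$ with constant $\gamma>0$ if $\|\eta_T\|_{\ell_1}\le\gamma\|\eta_{T^c}\|_{\ell_1}$ for all $\eta\in\mathcal{N}$ and all $T\subset\{1,\dots,N\}$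 with $\#T\le L$; here $\eta_S$ is obtained from $\eta$ by setting to zero all coordinates with index not in $S$. IRLS algorithm: set $w^0:=(1,\dots,1)$, $\epsilon_0:=1$. For $n=0,1,2,\dots$ define $$x^{n+1}:=\arg\min_{z\in\mathcal{F}(y)}\sum_{j=1}^N w^n_j z_j^2,\qquad \epsilon_{n+1}:=\min\Big(\epsilon_n,\frac{r(x^{n+1})_{K+1}}{N}\Big),\qquad w^{n+1}_j:=\big[(x^{n+1}_j)^2+\epsilon_{n+1}^2\big]^{-1/2}.$$ The integer $K$ in the update rule is the same $K$ as the order of the NSP. If $\epsilon_n=0$ the algorithm stops and one sets $x^j:=x^n$ for $j>n$. *)

theory Defs
  imports "HOL-Analysis.Analysis" "HOL-Library.Multiset"
begin

definition l1_norm :: "real ^ 'n \<Rightarrow> real" where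
  "l1_norm z = (\<Sum>i\<in>UNIV. \<bar>z $ i\<bar>)"

definition supp :: "real ^ 'n \<Rightarrow> 'n set" where
  "supp z = {i. z $ i \<noteq> 0}"

definition k_sparse :: "nat \<Rightarrow> real ^ 'n \<Rightarrow> bool" where
  "k_sparse k z \<longleftrightarrow> card (supp z) \<le> k"

definition restrict_vec :: "'n set \<Rightarrow> real ^ 'n \<Rightarrow> real ^ 'n" where
  "restrict_vec S z = (\<chi> i. if i \<in> S then z $ i else 0)"

definition kernel :: "real ^ 'n ^ 'm \<Rightarrow> (real ^ 'n) set" where
  "kernel \<Phi> = {z. \<Phi> *v z = 0}"

definition feasible :: "real ^ 'n ^ 'm \<Rightarrow> real ^ 'm \<Rightarrow> (real ^ 'n) set" where
  "feasible \<Phi> y = {z. \<Phi> *v z = y}"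

(* rearr z i is the i-th largest absolute entry, counted with multiplicity; the
   index i is 1-based and meaningful for 1 \<le> i \<le> CARD('n). *)
definition rearr :: "real ^ 'n \<Rightarrow> nat \<Rightarrow> real" where
  "rearr z i =
     rev (sorted_list_of_multiset (image_mset (\<lambda>j. \<bar>z $ j\<bar>) (mset_set UNIV))) ! (i - 1)"

definition nsp :: "real ^ 'n ^ 'm \<Rightarrow> nat \<Rightarrow> real \<Rightarrow> bool" where
  "nsp \<Phi> L \<gamma> \<longleftrightarrow> 0 < \<gamma> \<and>
     (\<forall>\<eta>\<in>kernel \<Phi>. \<forall>T. card T \<le> L \<longrightarrow>
        l1_norm (restrict_vec T \<eta>) \<le> \<gamma> * l1_norm (restrict_vec (- T) \<eta>))"

(* A state is a triple (x, \<epsilon>, w). Once \<epsilon> = 0 the algorithm has stopped and the state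
   stays fixed; the weights computed at that moment (where 0 powr (-1/2) = 0 may
   occur) are never used. The weights of a non-stopped state are positive, so the
   minimiser selected by arg_min is unique when the feasible set is nonempty. *)
definition irls_step ::
    "real ^ 'n ^ 'm \<Rightarrow> real ^ 'm \<Rightarrow> nat \<Rightarrow>
     (real ^ 'n) \<times> real \<times> (real ^ 'n) \<Rightarrow> (real ^ 'n) \<times> real \<times> (real ^ 'n)" where
  "irls_step \<Phi> y K = (\<lambda>(x, \<epsilon>, w).
     if \<epsilon> = 0 then (x, \<epsilon>, w)
     else
       let x' = arg_min (\<lambda>z. \<Sum>j\<in>UNIV. w $ j * (z $ j)\<^sup>2) (\<lambda>z. z \<in> feasible \<Phi> y);
           \<epsilon>' = min \<epsilon> (rearr x' (K + 1) / real CARD('n));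
           w' = (\<chi> j. ((x' $ j)\<^sup>2 + \<epsilon>'\<^sup>2) powr (- 1 / 2))
       in (x', \<epsilon>', w'))"

(* The algorithm has no iterate of index 0; the component 0 of the initial state is
   a placeholder that irls_step does not read, because the initial \<epsilon> is 1. *)
primrec irls ::
    "real ^ 'n ^ 'm \<Rightarrow> real ^ 'm \<Rightarrow> nat \<Rightarrow> nat \<Rightarrow>
     (real ^ 'n) \<times> real \<times> (real ^ 'n)" where
  "irls \<Phi> y K 0 = (0, 1, \<chi> j. 1)"
| "irls \<Phi> y K (Suc n) = irls_step \<Phi> y K (irls \<Phi> y K n)"

definition irls_x ::
    "real ^ 'n ^ 'm \<Rightarrow> real ^ 'm \<Rightarrow> nat \<Rightarrow> nat \<Rightarrow> real ^ 'n" where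
  "irls_x \<Phi> y K n = fst (irls \<Phi> y K n)"

definition converges_exponentially :: "(nat \<Rightarrow> 'a::metric_space) \<Rightarrow> 'a \<Rightarrow> bool" where
  "converges_exponentially X L \<longleftrightarrow>
     X \<longlonglongrightarrow> L \<and> (\<exists>C q. 0 < q \<and> q < 1 \<and> (\<forall>n. dist (X n) L \<le> C * q ^ n))"

end

theory Submission
  imports Defs
begin

text \<open>
  Write \<open>\<eta>\<close> for the error of the new iterate, \<open>\<eta> = x' - xs\<close>, and \<open>T\<close> for the support of \<open>xs\<close>. The new
  iterate minimises a weighted sum of squares over an affine space that also contains \<open>xs\<close>, so the
  weighted inner product of \<open>x'\<close> and \<open>\<eta>\<close> is not positive
  (\<open>weighted_ls_variational_inequality\<close>). Expanding \<open>x' = xs + \<eta>\<close> turns this into a bound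
  of the weighted energy of \<open>\<eta>\<close> by a sum over \<open>T\<close> only,
  \<open>\<Sum>\<^sub>i w\<^sub>i \<eta>\<^sub>i\<^sup>2 \<le> \<Sum>\<^sub>T w\<^sub>i \<bar>xs\<^sub>i\<bar> \<bar>\<eta>\<^sub>i\<bar>\<close>.

  If the old iterate \<open>x\<close> is within relative distance \<open>\<rho>\<close> of \<open>xs\<close> on \<open>T\<close>, then
  \<open>w\<^sub>i \<bar>xs\<^sub>i\<bar> \<le> 1 / (1 - \<rho>)\<close> there, because \<open>w\<^sub>i \<le> 1 / \<bar>x\<^sub>i\<bar>\<close>. The null space property moves the
  remaining \<open>\<ell>\<^sub>1\<close> mass from \<open>T\<close> to its complement. There the Cauchy--Schwarz inequality bounds the
  square of the \<open>\<ell>\<^sub>1\<close> mass of \<open>\<eta>\<close> by the energy times \<open>\<Sum> 1 / w\<^sub>i\<close>, and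
  \<open>1 / w\<^sub>i \<le> \<bar>x\<^sub>i\<bar> + \<epsilon>\<close> where \<open>\<bar>x\<^sub>i\<bar>\<close> is the old error, since \<open>xs\<close> vanishes off \<open>T\<close>. One factor of
  the \<open>\<ell>\<^sub>1\<close> mass cancels, and the new error is at most a multiple of the old error plus \<open>N \<epsilon>\<close>
  (\<open>reweighted_step_l1_bound\<close>).

  The update rule keeps \<open>N \<epsilon>\<close> below the \<open>(K + 1)\<close>-st largest entry of \<open>x\<close>, and at least \<open>K + 1 - k\<close>
  entries of that size lie off \<open>T\<close>, where they count as errors (\<open>rearr_le_l1_dist_sparse\<close>). This gives
  the factor \<open>1 + 1 / (K + 1 - k)\<close>. If \<open>\<epsilon> = 0\<close>, the iterate is \<open>K\<close>-sparse and feasible, and it is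
  already equal to \<open>xs\<close>, since two \<open>K\<close>-sparse feasible points are both the strict \<open>\<ell>\<^sub>1\<close> minimiser
  (\<open>nsp_sparse_unique\<close>).

  As the contraction factor is below one, the error never leaves the radius within which the estimate
  is valid, so the contraction repeats for all later steps.
\<close>

section \<open>The l1 norm and coordinate restriction\<close>

lemma l1_norm_restrict_vec: "l1_norm (restrict_vec S z) = (\<Sum>i\<in>S. \<bar>z $ i\<bar>)"
proof -
  have "l1_norm (restrict_vec S z) = (\<Sum>i\<in>UNIV. if i \<in> S then \<bar>z $ i\<bar> else 0)"
    unfolding l1_norm_def restrict_vec_def by (rule sum.cong) auto
  also have "\<dots> = (\<Sum>i\<in>S. \<bar>z $ i\<bar>)"
    by (simp add: sum.If_cases)
  finally show ?thesis .
qed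

lemma l1_norm_split: "l1_norm z = (\<Sum>i\<in>S. \<bar>z $ i\<bar>) + (\<Sum>i\<in>- S. \<bar>z $ i\<bar>)"
  unfolding l1_norm_def
  by (subst sum.union_disjoint[symmetric]) auto

lemma l1_norm_nonneg [simp]: "0 \<le> l1_norm z"
  unfolding l1_norm_def by (rule sum_nonneg) simp

lemma l1_norm_eq_0_iff [simp]: "l1_norm z = 0 \<longleftrightarrow> z = 0"
  unfolding l1_norm_def by (simp add: sum_nonneg_eq_0_iff vec_eq_iff)

lemma l1_norm_0 [simp]: "l1_norm 0 = 0"
  by simp

lemma abs_component_le_l1_norm: "\<bar>z $ i\<bar> \<le> l1_norm z"
  unfolding l1_norm_def by (rule member_le_sum) auto

section \<open>Decreasing rearrangement\<close>

text \<open>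
  In a decreasing list the entries from position \<open>p\<close> on are at most the entry at \<open>p\<close>, and the first
  \<open>p + 1\<close> entries are at least that entry. These two counts are all that is used about the decreasing
  rearrangement, and they are insensitive to ties.
\<close>

lemma length_filter_le_nth_sorted_desc:
  fixes xs :: "'a :: linorder list"
  assumes "sorted (rev xs)" "p < length xs"
  shows "length (filter (\<lambda>a. xs ! p < a) xs) \<le> p"
    and "Suc p \<le> length (filter (\<lambda>a. xs ! p \<le> a) xs)"
proof -
  have desc: "xs ! j \<le> xs ! i" if "i \<le> j" "j < length xs" for i j
    using sorted_rev_nth_mono[OF assms(1)] that by blast
  have "filter (\<lambda>a. xs ! p < a) (drop p xs) = []"
    using assms(2) by (auto simp: filter_empty_conv in_set_conv_nth not_less intro!: desc)
  hence "filter (\<lambda>a. xs ! p < a) xs = filter (\<lambda>a. xs ! p < a) (take p xs)"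
    by (subst (1) append_take_drop_id[of p xs, symmetric]) (simp only: filter_append append_Nil2)
  also have "length \<dots> \<le> p"
    using length_filter_le[of "\<lambda>a. xs ! p < a" "take p xs"] by simp
  finally show "length (filter (\<lambda>a. xs ! p < a) xs) \<le> p" .
  have "filter (\<lambda>a. xs ! p \<le> a) (take (Suc p) xs) = take (Suc p) xs"
    using assms(2) by (auto simp: filter_id_conv in_set_conv_nth intro!: desc)
  hence "filter (\<lambda>a. xs ! p \<le> a) xs =
      take (Suc p) xs @ filter (\<lambda>a. xs ! p \<le> a) (drop (Suc p) xs)"
    by (subst (2) append_take_drop_id[of "Suc p" xs, symmetric]) (simp only: filter_append)
  thus "Suc p \<le> length (filter (\<lambda>a. xs ! p \<le> a) xs)"
    using assms(2) by simp
qed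

lemma card_above_rearr:
  fixes z :: "real ^ 'n"
  assumes "p < CARD('n)"
  shows "card {j. rearr z (p + 1) < \<bar>z $ j\<bar>} \<le> p"
    and "Suc p \<le> card {j. rearr z (p + 1) \<le> \<bar>z $ j\<bar>}"
proof -
  define M where "M = image_mset (\<lambda>j. \<bar>z $ j\<bar>) (mset_set (UNIV :: 'n set))"
  define l where "l = rev (sorted_list_of_multiset M)"
  have mset_l: "mset l = M" by (simp add: l_def)
  have len: "length l = CARD('n)"
    by (metis mset_l M_def size_image_mset size_mset size_mset_set)
  have sorted: "sorted (rev l)" by (simp add: l_def)
  have nth: "rearr z (p + 1) = l ! p" by (simp add: rearr_def l_def M_def)
  have count: "length (filter P l) = card {j. P \<bar>z $ j\<bar>}" for P
  proof -
    have "length (filter P l) = size (filter_mset P M)"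
      by (metis mset_filter mset_l size_mset)
    also have "\<dots> = card {j. P \<bar>z $ j\<bar>}"
      by (simp add: M_def filter_mset_image_mset)
    finally show ?thesis .
  qed
  show "card {j. rearr z (p + 1) < \<bar>z $ j\<bar>} \<le> p"
    and "Suc p \<le> card {j. rearr z (p + 1) \<le> \<bar>z $ j\<bar>}"
    using length_filter_le_nth_sorted_desc[OF sorted, of p] assms
    unfolding nth by (simp_all add: len count)
qed

lemma rearr_nonneg:
  fixes z :: "real ^ 'n"
  assumes "p < CARD('n)"
  shows "0 \<le> rearr z (p + 1)"
proof (rule ccontr)
  assume "\<not> 0 \<le> rearr z (p + 1)"
  hence "{j. rearr z (p + 1) < \<bar>z $ j\<bar>} = UNIV"
    by (auto intro: less_le_trans[OF _ abs_ge_zero])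
  with card_above_rearr(1)[OF assms, of z] assms show False by simp
qed

text \<open>
  This is what stopping of the algorithm means: \<open>\<epsilon>\<close> vanishes only if the iterate is \<open>K\<close>-sparse.
\<close>

lemma card_supp_le_if_rearr_eq_0:
  fixes z :: "real ^ 'n"
  assumes "p < CARD('n)" "rearr z (p + 1) = 0"
  shows "card (supp z) \<le> p"
  using card_above_rearr(1)[OF assms(1), of z] unfolding assms(2) by (simp add: supp_def)

text \<open>
  At least \<open>p + 1\<close> entries of \<open>z\<close> reach the \<open>(p + 1)\<close>-st largest absolute value, and at most \<open>k\<close> of
  them lie in the support of \<open>z'\<close>. On each of the others the entry of \<open>z\<close> is itself the difference.
\<close>

lemma rearr_le_l1_dist_sparse:
  fixes z z' :: "real ^ 'n"
  assumes "p < CARD('n)" "card (supp z') \<le> k" "k \<le> p"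
  shows "(real p + 1 - real k) * rearr z (p + 1) \<le> l1_norm (z - z')"
proof -
  let ?r = "rearr z (p + 1)"
  let ?B = "{j. ?r \<le> \<bar>z $ j\<bar>}"
  have "Suc p - k \<le> card (?B - supp z')"
    using card_above_rearr(2)[OF assms(1), of z] assms(2)
      diff_card_le_card_Diff[of "supp z'" ?B] by simp
  hence "real p + 1 - real k \<le> real (card (?B - supp z'))" using assms(3) by simp
  hence "(real p + 1 - real k) * ?r \<le> real (card (?B - supp z')) * ?r"
    using rearr_nonneg[OF assms(1)] by (rule mult_right_mono)
  also have "\<dots> \<le> (\<Sum>j\<in>?B - supp z'. \<bar>(z - z') $ j\<bar>)"
    by (rule sum_bounded_below) (auto simp: supp_def)
  also have "\<dots> \<le> l1_norm (z - z')"
    unfolding l1_norm_def by (rule sum_mono2) auto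
  finally show ?thesis .
qed

section \<open>The null space property\<close>

lemma nspD:
  assumes "nsp \<Phi> L \<gamma>" "\<eta> \<in> kernel \<Phi>" "card T \<le> L"
  shows "(\<Sum>i\<in>T. \<bar>\<eta> $ i\<bar>) \<le> \<gamma> * (\<Sum>i\<in>- T. \<bar>\<eta> $ i\<bar>)"
  using assms by (auto simp: nsp_def l1_norm_restrict_vec)

text \<open>
  A matrix with fewer rows than columns has a nonzero kernel vector. If the order \<open>L\<close> allowed
  the set of all indices, the null space inequality for that set would bound its norm by zero. The consequence needed is that the \<open>(K + 1)\<close>-st largest
  entry in the update rule exists.
\<close>

lemma nsp_order_less_CARD:
  fixes \<Phi> :: "real ^ 'n ^ 'm"
  assumes "nsp \<Phi> L \<gamma>" "CARD('m) < CARD('n)"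
  shows "L < CARD('n)"
proof (rule ccontr)
  assume "\<not> L < CARD('n)"
  hence "l1_norm \<eta> \<le> 0" if "\<eta> \<in> kernel \<Phi>" for \<eta>
    using nspD[OF assms(1) that, of UNIV] by (simp add: l1_norm_def)
  hence "\<eta> = 0" if "\<Phi> *v \<eta> = 0" for \<eta>
    using that l1_norm_nonneg[of \<eta>] by (auto simp: kernel_def simp flip: l1_norm_eq_0_iff intro: antisym)
  hence "rank \<Phi> = CARD('n)"
    by (metis full_rank_injective matrix_left_invertible_injective matrix_left_invertible_ker)
  thus False using rank_bound[of \<Phi>] assms(2) by simp
qed

text \<open>
  Adding \<open>\<eta>\<close> can lower the norm on the support of \<open>x\<close> by at most the mass of \<open>\<eta>\<close> there, and it raises
  the norm off the support by the mass of \<open>\<eta>\<close> there. With a constant below one the second mass is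
  strictly larger.
\<close>

lemma nsp_l1_norm_strict_min:
  assumes "nsp \<Phi> L \<gamma>" "\<gamma> < 1" "card (supp x) \<le> L" "\<eta> \<in> kernel \<Phi>" "\<eta> \<noteq> 0"
  shows "l1_norm x < l1_norm (x + \<eta>)"
proof -
  let ?S = "supp x"
  let ?a = "\<Sum>i\<in>?S. \<bar>\<eta> $ i\<bar>" and ?b = "\<Sum>i\<in>- ?S. \<bar>\<eta> $ i\<bar>"
  have ab: "?a \<le> \<gamma> * ?b" using assms by (intro nspD)
  have "0 < l1_norm \<eta>" using assms(5) l1_norm_nonneg[of \<eta>] by (simp add: less_le del: l1_norm_nonneg)
  hence "?b \<noteq> 0" using ab l1_norm_split[of \<eta> ?S] by auto
  moreover have "0 \<le> ?b" by (rule sum_nonneg) simp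
  ultimately have "0 < ?b" by linarith
  hence "\<gamma> * ?b < ?b" using assms(2) by simp
  with ab have less: "?a < ?b" by simp
  have off: "(\<Sum>i\<in>- ?S. \<bar>x $ i\<bar>) = 0" "(\<Sum>i\<in>- ?S. \<bar>(x + \<eta>) $ i\<bar>) = ?b"
    by (auto simp: supp_def)
  have "(\<Sum>i\<in>?S. \<bar>x $ i\<bar>) \<le> (\<Sum>i\<in>?S. \<bar>(x + \<eta>) $ i\<bar> + \<bar>\<eta> $ i\<bar>)"
    by (rule sum_mono) auto
  thus ?thesis
    using less off l1_norm_split[of x ?S] l1_norm_split[of "x + \<eta>" ?S]
    by (simp add: sum.distrib)
qed

lemma nsp_sparse_unique:
  assumes "nsp \<Phi> L \<gamma>" "\<gamma> < 1" "card (supp x) \<le> L" "card (supp x') \<le> L"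
    and "x \<in> feasible \<Phi> y" "x' \<in> feasible \<Phi> y"
  shows "x = x'"
proof (rule ccontr)
  assume "x \<noteq> x'"
  moreover have "x' - x \<in> kernel \<Phi>" "x - x' \<in> kernel \<Phi>"
    using assms(5,6) by (auto simp: kernel_def feasible_def matrix_vector_mult_diff_distrib)
  ultimately have "l1_norm x < l1_norm (x + (x' - x))" "l1_norm x' < l1_norm (x' + (x - x'))"
    using assms by (intro nsp_l1_norm_strict_min; simp)+
  thus False by simp
qed

section \<open>Weighted least squares\<close>

text \<open>
  Scaling the coordinates by the square roots of the weights turns the problem into finding a point of
  least Euclidean norm in a nonempty closed set.
\<close>

lemma weighted_ls_minimizer_exists:
  fixes w :: "real ^ 'n" and \<Phi> :: "real ^ 'n ^ 'm"
  assumes "\<And>j. 0 < w $ j" "feasible \<Phi> y \<noteq> {}"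
  shows "\<exists>x. is_arg_min (\<lambda>z. \<Sum>j\<in>UNIV. w $ j * (z $ j)\<^sup>2) (\<lambda>z. z \<in> feasible \<Phi> y) x"
proof -
  define D :: "real ^ 'n \<Rightarrow> real ^ 'n" where "D z = (\<chi> j. sqrt (w $ j) * z $ j)" for z
  define D' :: "real ^ 'n \<Rightarrow> real ^ 'n" where "D' z = (\<chi> j. z $ j / sqrt (w $ j))" for z
  have w0: "w $ j \<noteq> 0" "0 \<le> w $ j" for j using assms(1)[of j] by auto
  have DD': "D (D' z) = z" "D' (D z) = z" for z
    by (simp_all add: D_def D'_def vec_eq_iff w0)
  have obj: "(\<Sum>j\<in>UNIV. w $ j * (z $ j)\<^sup>2) = (norm (D z))\<^sup>2" for z
    by (simp add: D_def norm_vec_def L2_set_def sum_nonneg power_mult_distrib w0)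
  have "continuous_on UNIV (\<lambda>u. \<Phi> *v D' u)"
    unfolding D'_def matrix_vector_mult_def
    by (intro continuous_intros ballI) (auto simp: w0)
  hence "closed ((\<lambda>u. \<Phi> *v D' u) -` {y})"
    by (intro closed_vimage) auto
  moreover from assms(2) obtain z where "\<Phi> *v z = y" by (auto simp: feasible_def)
  hence "D z \<in> (\<lambda>u. \<Phi> *v D' u) -` {y}" by (simp add: DD')
  ultimately obtain u where u: "\<Phi> *v D' u = y"
    and min: "\<And>v. \<Phi> *v D' v = y \<Longrightarrow> norm u \<le> norm v"
    using distance_attains_inf[of "(\<lambda>u. \<Phi> *v D' u) -` {y}" 0] by auto
  have "is_arg_min (\<lambda>z. \<Sum>j\<in>UNIV. w $ j * (z $ j)\<^sup>2) (\<lambda>z. z \<in> feasible \<Phi> y) (D' u)"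
    unfolding is_arg_min_linorder obj
    using u min[of "D _"] by (auto simp: feasible_def DD' intro!: power_mono)
  thus ?thesis by blast
qed

text \<open>
  Moving from the minimiser \<open>x\<close> towards \<open>z\<close> by a fraction \<open>t\<close> stays feasible and changes the objective
  by \<open>- 2 t c + t\<^sup>2 f (x - z)\<close>, where \<open>c\<close> is the sum in the conclusion and \<open>f\<close> the objective. This is
  nonnegative, and \<open>c \<le> 0\<close> follows for \<open>t\<close> tending to \<open>0\<close>.
\<close>

lemma weighted_ls_variational_inequality:
  fixes w x z :: "real ^ 'n"
  assumes "is_arg_min (\<lambda>z. \<Sum>j\<in>UNIV. w $ j * (z $ j)\<^sup>2) (\<lambda>z. z \<in> feasible \<Phi> y) x"
    and "z \<in> feasible \<Phi> y"
  shows "(\<Sum>j\<in>UNIV. w $ j * x $ j * (x - z) $ j) \<le> 0"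
proof -
  let ?f = "\<lambda>z :: real ^ 'n. \<Sum>j\<in>UNIV. w $ j * (z $ j)\<^sup>2"
  let ?c = "\<Sum>j\<in>UNIV. w $ j * x $ j * (x - z) $ j"
  have x: "x \<in> feasible \<Phi> y" and min: "\<And>z. z \<in> feasible \<Phi> y \<Longrightarrow> ?f x \<le> ?f z"
    using assms(1) by (auto simp: is_arg_min_linorder)
  have step: "2 * ?c \<le> t * ?f (x - z)" if "0 < t" for t
  proof -
    have "x - t *\<^sub>R (x - z) \<in> feasible \<Phi> y"
      using x assms(2)
      by (simp add: feasible_def matrix_vector_mult_diff_distrib matrix_vector_mult_scaleR)
    hence "?f x \<le> ?f (x - t *\<^sub>R (x - z))" by (rule min)
    also have "\<dots> = (\<Sum>j\<in>UNIV. w $ j * (x $ j)\<^sup>2 - 2 * t * (w $ j * x $ j * (x - z) $ j)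
        + t\<^sup>2 * (w $ j * ((x - z) $ j)\<^sup>2))"
      by (rule sum.cong) (auto simp: power2_eq_square algebra_simps)
    also have "\<dots> = ?f x - 2 * t * ?c + t\<^sup>2 * ?f (x - z)"
      by (simp only: sum.distrib sum_subtractf sum_distrib_left)
    finally have "t * (2 * ?c) \<le> t * (t * ?f (x - z))"
      by (simp add: power2_eq_square algebra_simps)
    thus ?thesis using that by simp
  qed
  have "((\<lambda>t. t * ?f (x - z)) \<longlongrightarrow> 0 * ?f (x - z)) (at_right 0)"
    by (intro tendsto_intros)
  moreover have "eventually (\<lambda>t. 2 * ?c \<le> t * ?f (x - z)) (at_right 0)"
    by (rule eventually_mono[OF eventually_at_right_less[of 0]]) (rule step)
  ultimately have "2 * ?c \<le> 0 * ?f (x - z)"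
    by (rule tendsto_lowerbound) simp
  thus ?thesis by simp
qed

section \<open>One reweighted step\<close>

text \<open>
  The central estimate: an energy bound on the support of \<open>xs\<close> (variational inequality), the null space
  property, and the Cauchy--Schwarz inequality off the support. The bound keeps \<open>\<epsilon>\<close> explicit; how the
  algorithm chooses \<open>\<epsilon>\<close> enters only later.
\<close>

lemma reweighted_step_l1_bound:
  fixes x x' xs w :: "real ^ 'n" and \<Phi> :: "real ^ 'n ^ 'm"
  assumes nsp: "nsp \<Phi> K \<gamma>"
    and "0 < \<epsilon>" and w: "\<And>j. w $ j = ((x $ j)\<^sup>2 + \<epsilon>\<^sup>2) powr (- 1 / 2)"
    and min: "is_arg_min (\<lambda>z. \<Sum>j\<in>UNIV. w $ j * (z $ j)\<^sup>2) (\<lambda>z. z \<in> feasible \<Phi> y) x'"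
    and xs: "xs \<in> feasible \<Phi> y" "card (supp xs) \<le> K"
    and near: "\<And>i. i \<in> supp xs \<Longrightarrow> \<bar>(x - xs) $ i\<bar> \<le> \<rho> * \<bar>xs $ i\<bar>"
    and "\<rho> < 1"
  shows "l1_norm (x' - xs)
    \<le> \<gamma> * (1 + \<gamma>) / (1 - \<rho>) * (l1_norm (x - xs) + real CARD('n) * \<epsilon>)"
proof -
  define \<eta> where "\<eta> = x' - xs"
  let ?T = "supp xs"
  let ?a = "\<Sum>i\<in>?T. \<bar>\<eta> $ i\<bar>" and ?b = "\<Sum>i\<in>- ?T. \<bar>\<eta> $ i\<bar>"
  let ?Q = "\<Sum>i\<in>UNIV. w $ i * (\<eta> $ i)\<^sup>2"
  let ?d = "l1_norm (x - xs) + real CARD('n) * \<epsilon>"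
  have \<gamma>: "0 < \<gamma>" using nsp by (simp add: nsp_def)
  \<comment> \<open>The reciprocal weights are the natural quantity: they compare directly with \<open>\<bar>x $ j\<bar>\<close>.\<close>
  define s where "s j = sqrt ((x $ j)\<^sup>2 + \<epsilon>\<^sup>2)" for j
  have s_pos: "0 < s j" for j
    using \<open>0 < \<epsilon>\<close> by (simp add: s_def sum_power2_gt_zero_iff)
  have w_s: "w $ j = 1 / s j" for j
    using powr_minus_divide[of "(x $ j)\<^sup>2 + \<epsilon>\<^sup>2" "1 / 2"]
    by (simp only: w s_def powr_half_sqrt sum_power2_ge_zero minus_divide_left)
  have w_pos: "0 < w $ j" for j using s_pos by (simp add: w_s)
  have "\<eta> \<in> kernel \<Phi>"
    using min xs(1)
    by (auto simp: \<eta>_def kernel_def feasible_def matrix_vector_mult_diff_distrib is_arg_min_linorder)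
  hence ab: "?a \<le> \<gamma> * ?b" using nsp xs(2) by (intro nspD)
  have b0: "0 \<le> ?b" by (rule sum_nonneg) simp
  have "(\<Sum>i\<in>UNIV. w $ i * x' $ i * \<eta> $ i) \<le> 0"
    unfolding \<eta>_def by (rule weighted_ls_variational_inequality[OF min xs(1)])
  moreover have "(\<Sum>i\<in>UNIV. w $ i * x' $ i * \<eta> $ i) = ?Q + (\<Sum>i\<in>UNIV. w $ i * xs $ i * \<eta> $ i)"
    by (simp add: \<eta>_def sum.distrib[symmetric] power2_eq_square algebra_simps)
  moreover have "(\<Sum>i\<in>UNIV. w $ i * xs $ i * \<eta> $ i) = (\<Sum>i\<in>?T. w $ i * xs $ i * \<eta> $ i)"
    by (rule sum.mono_neutral_right) (auto simp: supp_def)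
  ultimately have "?Q \<le> (\<Sum>i\<in>?T. - (w $ i * xs $ i * \<eta> $ i))"
    by (simp add: sum_negf)
  also have "\<dots> \<le> (\<Sum>i\<in>?T. 1 / (1 - \<rho>) * \<bar>\<eta> $ i\<bar>)"
  proof (rule sum_mono)
    fix i assume i: "i \<in> ?T"
    have "(1 - \<rho>) * \<bar>xs $ i\<bar> \<le> \<bar>x $ i\<bar>"
      using near[OF i] by (simp add: algebra_simps)
    also have "\<dots> \<le> s i" unfolding s_def by (rule real_le_rsqrt) simp
    finally have "w $ i * \<bar>xs $ i\<bar> \<le> 1 / (1 - \<rho>)"
      using s_pos[of i] \<open>\<rho> < 1\<close> by (simp add: w_s field_simps)
    hence "w $ i * \<bar>xs $ i\<bar> * \<bar>\<eta> $ i\<bar> \<le> 1 / (1 - \<rho>) * \<bar>\<eta> $ i\<bar>"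
      by (rule mult_right_mono) simp
    moreover have "- (w $ i * xs $ i * \<eta> $ i) \<le> w $ i * \<bar>xs $ i\<bar> * \<bar>\<eta> $ i\<bar>"
      using w_pos[of i] abs_ge_minus_self[of "w $ i * xs $ i * \<eta> $ i"] by (simp add: abs_mult)
    ultimately show "- (w $ i * xs $ i * \<eta> $ i) \<le> 1 / (1 - \<rho>) * \<bar>\<eta> $ i\<bar>" by simp
  qed
  also have "\<dots> = 1 / (1 - \<rho>) * ?a" by (rule sum_distrib_left[symmetric])
  also have "\<dots> \<le> 1 / (1 - \<rho>) * (\<gamma> * ?b)"
    using ab \<open>\<rho> < 1\<close> by (intro mult_left_mono) auto
  finally have Q: "?Q \<le> \<gamma> / (1 - \<rho>) * ?b" by simp
  have Q0: "0 \<le> ?Q" by (intro sum_nonneg mult_nonneg_nonneg) (simp_all add: w_pos less_imp_le)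
  \<comment> \<open>Splitting each entry as \<open>(sqrt w \<bar>\<eta>\<bar>) * sqrt (1 / w)\<close> prepares the Cauchy--Schwarz inequality.\<close>
  have "?b = (\<Sum>i\<in>- ?T. (sqrt (w $ i) * \<bar>\<eta> $ i\<bar>) * sqrt (s i))"
    using s_pos by (intro sum.cong) (simp_all add: w_s real_sqrt_divide less_imp_neq[symmetric])
  hence "?b\<^sup>2 \<le> (\<Sum>i\<in>- ?T. (sqrt (w $ i) * \<bar>\<eta> $ i\<bar>)\<^sup>2) * (\<Sum>i\<in>- ?T. (sqrt (s i))\<^sup>2)"
    using Cauchy_Schwarz_ineq_sum[of "\<lambda>i. sqrt (w $ i) * \<bar>\<eta> $ i\<bar>" "\<lambda>i. sqrt (s i)" "- ?T"]
    by simp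
  also have "\<dots> = (\<Sum>i\<in>- ?T. w $ i * (\<eta> $ i)\<^sup>2) * (\<Sum>i\<in>- ?T. s i)"
    using s_pos w_pos by (simp add: power_mult_distrib less_imp_le)
  also have "\<dots> \<le> ?Q * ?d"
  proof (rule mult_mono)
    show "(\<Sum>i\<in>- ?T. w $ i * (\<eta> $ i)\<^sup>2) \<le> ?Q"
      by (rule sum_mono2) (auto simp: w_pos less_imp_le)
    have "(\<Sum>i\<in>- ?T. s i) \<le> (\<Sum>i\<in>- ?T. \<bar>(x - xs) $ i\<bar> + \<epsilon>)"
    proof (rule sum_mono)
      fix i assume "i \<in> - ?T"
      hence "xs $ i = 0" by (simp add: supp_def)
      thus "s i \<le> \<bar>(x - xs) $ i\<bar> + \<epsilon>"
        using sqrt_sum_squares_le_sum_abs[of "x $ i" \<epsilon>] \<open>0 < \<epsilon>\<close> by (simp add: s_def)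
    qed
    also have "\<dots> \<le> (\<Sum>i\<in>UNIV. \<bar>(x - xs) $ i\<bar> + \<epsilon>)"
      using \<open>0 < \<epsilon>\<close> by (intro sum_mono2) auto
    also have "\<dots> = ?d" by (simp add: sum.distrib l1_norm_def)
    finally show "(\<Sum>i\<in>- ?T. s i) \<le> ?d" .
    show "0 \<le> (\<Sum>i\<in>- ?T. s i)" using s_pos by (intro sum_nonneg) (simp add: less_imp_le)
  qed (rule Q0)
  also have "\<dots> \<le> (\<gamma> / (1 - \<rho>) * ?b) * ?d"
    using Q \<open>0 < \<epsilon>\<close> by (intro mult_right_mono) auto
  \<comment> \<open>One factor \<open>?b\<close> cancels; if it is zero the bound holds because its right side is nonnegative.\<close>
  finally have "?b * ?b \<le> ?b * (\<gamma> / (1 - \<rho>) * ?d)"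
    by (simp add: power2_eq_square mult_ac)
  moreover have "0 \<le> \<gamma> / (1 - \<rho>) * ?d"
    using \<gamma> \<open>0 < \<epsilon>\<close> \<open>\<rho> < 1\<close> by (intro mult_nonneg_nonneg add_nonneg_nonneg) auto
  ultimately have b: "?b \<le> \<gamma> / (1 - \<rho>) * ?d"
    using b0 by (metis mult_left_le_imp_le order_le_less)
  have "l1_norm (x' - xs) \<le> (1 + \<gamma>) * ?b"
    using ab l1_norm_split[of \<eta> ?T] by (simp add: \<eta>_def algebra_simps)
  also have "\<dots> \<le> (1 + \<gamma>) * (\<gamma> / (1 - \<rho>) * ?d)"
    using b \<gamma> by (intro mult_left_mono) auto
  finally show ?thesis by (simp add: mult_ac)
qed

section \<open>The iterates of the algorithm\<close>

definition irls_eps :: "real ^ 'n ^ 'm \<Rightarrow> real ^ 'm \<Rightarrow> nat \<Rightarrow> nat \<Rightarrow> real" where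
  "irls_eps \<Phi> y K n = fst (snd (irls \<Phi> y K n))"

definition irls_w :: "real ^ 'n ^ 'm \<Rightarrow> real ^ 'm \<Rightarrow> nat \<Rightarrow> nat \<Rightarrow> real ^ 'n" where
  "irls_w \<Phi> y K n = snd (snd (irls \<Phi> y K n))"

lemma irls_0: "irls_eps \<Phi> y K 0 = 1" "irls_w \<Phi> y K 0 = (\<chi> j. 1)"
  by (simp_all add: irls_eps_def irls_w_def)

lemma irls_Suc_stopped:
  assumes "irls_eps \<Phi> y K n = 0"
  shows "irls_x \<Phi> y K (Suc n) = irls_x \<Phi> y K n" "irls_eps \<Phi> y K (Suc n) = 0"
  using assms by (auto simp: irls_eps_def irls_x_def irls_step_def split: prod.splits)

lemma irls_Suc_running:
  fixes \<Phi> :: "real ^ 'n ^ 'm"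
  assumes "irls_eps \<Phi> y K n \<noteq> 0"
  shows "irls_x \<Phi> y K (Suc n) =
      arg_min (\<lambda>z. \<Sum>j\<in>UNIV. irls_w \<Phi> y K n $ j * (z $ j)\<^sup>2) (\<lambda>z. z \<in> feasible \<Phi> y)"
    and "irls_eps \<Phi> y K (Suc n) =
      min (irls_eps \<Phi> y K n) (rearr (irls_x \<Phi> y K (Suc n)) (K + 1) / real CARD('n))"
    and "irls_w \<Phi> y K (Suc n) $ j =
      ((irls_x \<Phi> y K (Suc n) $ j)\<^sup>2 + (irls_eps \<Phi> y K (Suc n))\<^sup>2) powr (- 1 / 2)"
  using assms
  by (auto simp: irls_eps_def irls_x_def irls_w_def irls_step_def Let_def split: prod.splits)

lemma irls_eps_nonneg:
  fixes \<Phi> :: "real ^ 'n ^ 'm"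
  assumes "K < CARD('n)"
  shows "0 \<le> irls_eps \<Phi> y K n"
proof (induction n)
  case 0 show ?case by (simp add: irls_0)
next
  case (Suc n)
  thus ?case
    using rearr_nonneg[OF assms, of "irls_x \<Phi> y K (Suc n)"]
    by (cases "irls_eps \<Phi> y K n = 0") (auto simp: irls_Suc_stopped irls_Suc_running(2))
qed

lemma irls_eps_Suc_neq_0D:
  "irls_eps \<Phi> y K (Suc n) \<noteq> 0 \<Longrightarrow> irls_eps \<Phi> y K n \<noteq> 0"
  by (auto simp: irls_Suc_stopped)

text \<open>
  Positivity of the weights, which makes the minimisation of the next step well posed, is lost only once
  \<open>\<epsilon>\<close> is zero.
\<close>

lemma irls_w_pos:
  assumes "irls_eps \<Phi> y K n \<noteq> 0"
  shows "0 < irls_w \<Phi> y K n $ j"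
proof (cases n)
  case 0 thus ?thesis by (simp add: irls_0)
next
  case (Suc m)
  thus ?thesis
    using assms irls_eps_Suc_neq_0D[of \<Phi> y K m]
    by (simp add: irls_Suc_running(3) add_nonneg_eq_0_iff)
qed

lemma irls_x_Suc_is_arg_min:
  assumes "irls_eps \<Phi> y K n \<noteq> 0" "feasible \<Phi> y \<noteq> {}"
  shows "is_arg_min (\<lambda>z. \<Sum>j\<in>UNIV. irls_w \<Phi> y K n $ j * (z $ j)\<^sup>2)
    (\<lambda>z. z \<in> feasible \<Phi> y) (irls_x \<Phi> y K (Suc n))"
  unfolding irls_Suc_running(1)[OF assms(1)] arg_min_def
  using weighted_ls_minimizer_exists[OF irls_w_pos[OF assms(1)] assms(2)] by (rule someI_ex)

lemma irls_x_Suc_feasible: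
  assumes "feasible \<Phi> y \<noteq> {}"
  shows "irls_x \<Phi> y K (Suc n) \<in> feasible \<Phi> y"
proof (induction n)
  case 0 show ?case
    using irls_x_Suc_is_arg_min[of \<Phi> y K 0] assms by (simp add: irls_0 is_arg_min_linorder)
next
  case (Suc n) thus ?case
    using irls_x_Suc_is_arg_min[of \<Phi> y K "Suc n"] assms
    by (cases "irls_eps \<Phi> y K (Suc n) = 0") (auto simp: irls_Suc_stopped is_arg_min_linorder)
qed

text \<open>
  The update rule gives this bound as long as the algorithm runs; after stopping the left side is zero.
\<close>

lemma irls_eps_Suc_le:
  fixes \<Phi> :: "real ^ 'n ^ 'm"
  assumes "K < CARD('n)"
  shows "real CARD('n) * irls_eps \<Phi> y K (Suc n) \<le> rearr (irls_x \<Phi> y K (Suc n)) (K + 1)"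
proof (cases "irls_eps \<Phi> y K n = 0")
  case True
  thus ?thesis using rearr_nonneg[OF assms] by (simp add: irls_Suc_stopped)
next
  case False
  hence "irls_eps \<Phi> y K (Suc n) \<le> rearr (irls_x \<Phi> y K (Suc n)) (K + 1) / real CARD('n)"
    by (simp add: irls_Suc_running(2))
  thus ?thesis by (simp add: field_simps)
qed

text \<open>
  Since \<open>\<epsilon>\<close> starts at one, it can become zero only by a minimum with a vanishing entry of the
  rearrangement, and from then on the iterate does not change.
\<close>

lemma irls_stopped_rearr_eq_0:
  fixes \<Phi> :: "real ^ 'n ^ 'm"
  shows "irls_eps \<Phi> y K (Suc n) = 0 \<Longrightarrow> rearr (irls_x \<Phi> y K (Suc n)) (K + 1) = 0"
proof (induction n)
  case 0 thus ?case
    by (auto simp: irls_Suc_running(2) irls_0 min_def split: if_splits)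
next
  case (Suc n) thus ?case
    by (cases "irls_eps \<Phi> y K (Suc n) = 0")
      (auto simp: irls_Suc_stopped irls_Suc_running(2) min_def split: if_splits)
qed

text \<open>
  The index is shifted to \<open>Suc n\<close> because the initial state carries no iterate: only from index one on
  is \<open>\<epsilon>\<close> controlled by the iterate, and are the weights computed from it.
\<close>

lemma irls_error_contraction:
  fixes \<Phi> :: "real ^ 'n ^ 'm"
  assumes "CARD('m) < CARD('n)" and nsp: "nsp \<Phi> K \<gamma>" and "\<gamma> < 1"
    and xs: "xs \<in> feasible \<Phi> y" "card (supp xs) \<le> k" and "k \<le> K" and "\<rho> < 1"
    and near: "\<And>i. i \<in> supp xs \<Longrightarrow> \<bar>(irls_x \<Phi> y K (Suc n) - xs) $ i\<bar> \<le> \<rho> * \<bar>xs $ i\<bar>"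
  shows "l1_norm (irls_x \<Phi> y K (Suc (Suc n)) - xs)
    \<le> \<gamma> * (1 + \<gamma>) / (1 - \<rho>) * (1 + 1 / (real K + 1 - real k))
      * l1_norm (irls_x \<Phi> y K (Suc n) - xs)"
proof -
  let ?x = "irls_x \<Phi> y K (Suc n)" and ?\<epsilon> = "irls_eps \<Phi> y K (Suc n)"
  have K: "K < CARD('n)" by (rule nsp_order_less_CARD[OF nsp assms(1)])
  have ne: "feasible \<Phi> y \<noteq> {}" using xs(1) by auto
  have supp_le: "card (supp xs) \<le> K" using xs(2) \<open>k \<le> K\<close> by simp
  show ?thesis
  proof (cases "?\<epsilon> = 0")
    case True
    hence "card (supp ?x) \<le> K"
      by (intro card_supp_le_if_rearr_eq_0[OF K] irls_stopped_rearr_eq_0)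
    hence "?x = xs"
      using nsp_sparse_unique[OF nsp \<open>\<gamma> < 1\<close> _ supp_le irls_x_Suc_feasible[OF ne] xs(1)] by blast
    thus ?thesis using True by (simp add: irls_Suc_stopped)
  next
    case False
    have \<epsilon>: "0 < ?\<epsilon>" using False irls_eps_nonneg[OF K, of \<Phi> y "Suc n"] by simp
    have w: "irls_w \<Phi> y K (Suc n) $ j = ((?x $ j)\<^sup>2 + ?\<epsilon>\<^sup>2) powr (- 1 / 2)" for j
      by (rule irls_Suc_running(3)[OF irls_eps_Suc_neq_0D[OF False]])
    let ?c = "real K + 1 - real k"
    have c: "0 < ?c" using \<open>k \<le> K\<close> by simp
    have "?c * (real CARD('n) * ?\<epsilon>) \<le> ?c * rearr ?x (K + 1)"
      using irls_eps_Suc_le[OF K] c by (intro mult_left_mono) auto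
    also have "\<dots> \<le> l1_norm (?x - xs)"
      by (rule rearr_le_l1_dist_sparse[OF K xs(2) \<open>k \<le> K\<close>])
    finally have "real CARD('n) * ?\<epsilon> \<le> 1 / ?c * l1_norm (?x - xs)"
      using c by (simp add: field_simps)
    hence d: "l1_norm (?x - xs) + real CARD('n) * ?\<epsilon> \<le> (1 + 1 / ?c) * l1_norm (?x - xs)"
      by (simp add: algebra_simps)
    have "l1_norm (irls_x \<Phi> y K (Suc (Suc n)) - xs)
      \<le> \<gamma> * (1 + \<gamma>) / (1 - \<rho>) * (l1_norm (?x - xs) + real CARD('n) * ?\<epsilon>)"
      by (rule reweighted_step_l1_bound[OF nsp \<epsilon> w irls_x_Suc_is_arg_min[OF False ne]
            xs(1) supp_le near \<open>\<rho> < 1\<close>])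
    also have "\<dots> \<le> \<gamma> * (1 + \<gamma>) / (1 - \<rho>) * ((1 + 1 / ?c) * l1_norm (?x - xs))"
      using d nsp \<open>\<rho> < 1\<close> by (intro mult_left_mono) (auto simp: nsp_def)
    finally show ?thesis by (simp only: mult.assoc)
  qed
qed

section \<open>Exponential convergence\<close>

text \<open>
  The exponential bound has to hold from index zero on although the contraction starts at \<open>n0\<close>. The
  constant therefore sums the ratios \<open>e n / q ^ n\<close> over the finitely many early indices, which makes it
  an upper bound for each of them.
\<close>

lemma converges_exponentially_if_eventually_contracting:
  fixes X :: "nat \<Rightarrow> real ^ 'n"
  assumes "0 < q" "q < 1"
    and contr: "\<And>n. n0 \<le> n \<Longrightarrow> l1_norm (X (Suc n) - L) \<le> q * l1_norm (X n - L)"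
  shows "converges_exponentially X L"
proof -
  define e where "e n = l1_norm (X n - L)" for n
  define C where "C = (\<Sum>n\<le>n0. e n / q ^ n)"
  have e0: "0 \<le> e n" for n by (simp add: e_def)
  have early: "e n \<le> C * q ^ n" if "n \<le> n0" for n
  proof -
    have "e n / q ^ n \<le> C"
      unfolding C_def using that e0 \<open>0 < q\<close> by (intro member_le_sum) auto
    thus ?thesis using \<open>0 < q\<close> by (simp add: field_simps)
  qed
  have late: "e n \<le> C * q ^ n" if "n0 \<le> n" for n
    using that
  proof (induction n rule: dec_induct)
    case base show ?case by (rule early) simp
  next
    case (step n)
    have "e (Suc n) \<le> q * e n" unfolding e_def by (rule contr) (rule step)
    also have "\<dots> \<le> q * (C * q ^ n)" using step.IH \<open>0 < q\<close> by simp
    finally show ?case by (simp add: mult_ac)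
  qed
  have bound: "dist (X n) L \<le> C * q ^ n" for n
  proof -
    have "dist (X n) L \<le> e n"
      unfolding e_def l1_norm_def dist_norm by (rule norm_le_l1_cart)
    also have "\<dots> \<le> C * q ^ n" using early late by (meson nat_le_linear)
    finally show ?thesis .
  qed
  have "(\<lambda>n. C * q ^ n) \<longlonglongrightarrow> C * 0"
    using assms(1,2) by (intro tendsto_intros LIMSEQ_power_zero) auto
  hence "(\<lambda>n. C * q ^ n) \<longlonglongrightarrow> 0" by simp
  hence "(\<lambda>n. dist (X n) L) \<longlonglongrightarrow> 0"
    by (rule Lim_null_comparison[rotated]) (simp add: bound)
  hence "X \<longlonglongrightarrow> L" by (rule tendsto_dist_iff[THEN iffD2])
  with bound assms(1,2) show ?thesis unfolding converges_exponentially_def by blast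
qed

theorem theorem6p1:
  fixes \<Phi> :: "real ^ 'n ^ 'm" and y :: "real ^ 'm" and xs :: "real ^ 'n"
    and K k n0 :: nat and \<gamma> \<rho> \<mu> :: real and E :: "nat \<Rightarrow> real"
  defines "\<mu> \<equiv> \<gamma> * (1 + \<gamma>) / (1 - \<rho>) * (1 + 1 / (real K + 1 - real k))"
    and "E \<equiv> (\<lambda>n. l1_norm (irls_x \<Phi> y K n - xs))"
  assumes "CARD('m) < CARD('n)"
    and "rank \<Phi> = CARD('m)"
    and "0 < K"
    and "nsp \<Phi> K \<gamma>"
    and "0 < \<gamma>" and "\<gamma> < 1 - 2 / (real K + 2)"
    and "real k < real K - 2 * \<gamma> / (1 - \<gamma>)"
    and "0 < \<rho>" and "\<rho> < 1"
    and "\<mu> < 1"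
    and "xs \<in> feasible \<Phi> y" and "k_sparse k xs"
    and "1 \<le> n0"
    and "supp xs \<noteq> {} \<Longrightarrow> E n0 \<le> \<rho> * Min ((\<lambda>i. \<bar>xs $ i\<bar>) ` supp xs)"
  shows "(\<forall>n\<ge>n0. E (Suc n) \<le> \<mu> * E n) \<and>
         converges_exponentially (irls_x \<Phi> y K) xs"
proof -
  have "0 < 2 / (real K + 2)" by simp
  with \<open>\<gamma> < 1 - 2 / (real K + 2)\<close> have "\<gamma> < 1" by linarith
  with \<open>0 < \<gamma>\<close> have "0 < 2 * \<gamma> / (1 - \<gamma>)" by simp
  with \<open>real k < real K - 2 * \<gamma> / (1 - \<gamma>)\<close> have kK: "k \<le> K" by simp
  have "0 < \<gamma> * (1 + \<gamma>) / (1 - \<rho>)" "0 < 1 + 1 / (real K + 1 - real k)"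
    using \<open>0 < \<gamma>\<close> \<open>\<rho> < 1\<close> kK by (auto intro!: divide_pos_pos mult_pos_pos add_pos_nonneg)
  hence \<mu>0: "0 < \<mu>" unfolding \<mu>_def by (rule mult_pos_pos)
  \<comment> \<open>Stated entry by entry, the closeness condition is vacuous when the support is empty, so the case
      \<open>xs = 0\<close>, where \<open>Min\<close> is unspecified, needs no separate treatment.\<close>
  define near where
    "near n \<longleftrightarrow> (\<forall>i\<in>supp xs. E n \<le> \<rho> * \<bar>xs $ i\<bar>)" for n
  have contr: "E (Suc n) \<le> \<mu> * E n" if "n0 \<le> n" "near n" for n
  proof -
    obtain m where m: "n = Suc m" using \<open>n0 \<le> n\<close> \<open>1 \<le> n0\<close> by (cases n) auto
    have "\<bar>(irls_x \<Phi> y K n - xs) $ i\<bar> \<le> \<rho> * \<bar>xs $ i\<bar>" if "i \<in> supp xs" for i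
      using \<open>near n\<close> that abs_component_le_l1_norm[of "irls_x \<Phi> y K n - xs" i]
      unfolding near_def E_def by (meson order_trans)
    thus ?thesis
      using irls_error_contraction[OF \<open>CARD('m) < CARD('n)\<close> \<open>nsp \<Phi> K \<gamma>\<close> \<open>\<gamma> < 1\<close>
          \<open>xs \<in> feasible \<Phi> y\<close> _ kK \<open>\<rho> < 1\<close>, of m] \<open>k_sparse k xs\<close>
      unfolding \<mu>_def E_def k_sparse_def m by blast
  qed
  have near: "near n" if "n0 \<le> n" for n
    using that
  proof (induction n rule: dec_induct)
    case base
    have "\<rho> * Min ((\<lambda>i. \<bar>xs $ i\<bar>) ` supp xs) \<le> \<rho> * \<bar>xs $ i\<bar>" if "i \<in> supp xs" for i
      using that \<open>0 < \<rho>\<close> by simp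
    thus ?case
      using assms(16) unfolding near_def by (metis empty_iff order_trans)
  next
    case (step n)
    have "0 \<le> E n" by (simp add: E_def)
    hence "\<mu> * E n \<le> E n" using \<open>\<mu> < 1\<close> by (simp add: mult_left_le_one_le \<mu>0 less_imp_le)
    with contr[OF step.hyps(1) step.IH] have "E (Suc n) \<le> E n" by simp
    with step.IH show ?case unfolding near_def by (meson order_trans)
  qed
  have contr: "E (Suc n) \<le> \<mu> * E n" if "n0 \<le> n" for n
    using contr near that by blast
  hence "converges_exponentially (irls_x \<Phi> y K) xs"
    using \<mu>0 \<open>\<mu> < 1\<close> unfolding E_def
    by (intro converges_exponentially_if_eventually_contracting)
  with contr show ?thesis by blast
qed

end
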